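(* Consider the urban V2V URLLC system operating in the underlay mode described in the context, with either the regular pilot (RP) or the superimposed pilot (SP) scheme, and fix a cellular user (CUE) $k$. (1) For fixed numbers of V2V pairs $D_u$, fixed powers and fixed large-scale fading coefficients, the SINR $\gamma^{\mathrm C}_k$ of CUE $k$ averaged over the pilot allocation satisfies $\mathbb E_\chi[\gamma^{\mathrm C}_k]\ge\Gamma^{\mathrm C}_k$, where, for RP, $$\Gamma^{\mathrm C}_k=\frac{\tau_{\mathrm{RP}}\,p^{\mathrm C}_kq^{\mathrm C}_k(\beta^{\mathrm{C2B}}_k)^2}{\sum_{u=1}^4\sum_{d=1}^{D_u}p^{\mathrm V}_{ud}q^{\mathrm V}_{ud}(\beta^{\mathrm{V2B}}_{ud})^2},$$ and, for SP, $$\Gamma^{\mathrm C}_k=\frac{\tau_{\mathrm{SP}}\,p^{\mathrm C}_kq^{\mathrm C}_k(\beta^{\mathrm{C2B}}_k)^2}{\sum_{u=1}^4\sum_{d=1}^{D_u}p^{\mathrm V}_{ud}q^{\mathrm V}_{ud}(\beta^{\mathrm{V2B}}_{ud})^2+\sum_{k'=1}^K(p^{\mathrm C}_{k'})^2(\beta^{\mathrm{C2B}}_{k'})^2+\sum_{u=1}^4\sum_{d=1}^{D_u}(p^{\mathrm V}_{ud})^2(\beta^{\mathrm{V2B}}_{ud})^2}.$$ (2) In the worst case without resource allocation (all powers as specified in the context), the lower bound averaged over the vehicle density (the random numbers $D_u$) and the large-scale fading (the random distances) satisfies $\mathbb E[\Gamma^{\mathrm C}_k]\ge\bar\Gamma^{\mathrm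 C}_k$, where $$\bar\Gamma^{\mathrm C}_k=\frac{2\tau_{\mathrm{RP}}\psi^2}{\sum_{u=1}^4\rho_uS_{\mathrm R}\,\Omega^{\mathrm{V2B}}_{\mathrm N}\Omega^{\mathrm{C2B}}_{\mathrm P}}\ \text{ for RP},\qquad \bar\Gamma^{\mathrm C}_k=\frac{\tau_{\mathrm{SP}}\psi^2}{\sum_{u=1}^4\rho_uS_{\mathrm R}\,\Omega^{\mathrm{V2B}}_{\mathrm N}\Omega^{\mathrm{C2B}}_{\mathrm P}+K\psi^2\,\Omega^{\mathrm{C2B}}_{\mathrm N}\Omega^{\mathrm{C2B}}_{\mathrm P}}\ \text{ for SP}.$$
   Context: **Layout.** Four roads $u\in\{1,2,3,4\}$, each of length $A_{\mathrm{RL}}$, width $A_{\mathrm{RW}}$ and area $S_{\mathrm R}=A_{\mathrm{RL}}A_{\mathrm{RW}}$, surround a square block with a base station (BS) at its centre. Road $u$ carries $D_u$ V2V (vehicle-to-vehicle) pairs $(u,1),\dots,(u,D_u)$. There are $K\ge1$ CUEs, all communicating with the BS. **Pilots.** $\tau_{\mathrm{SP}}$ is the number of symbols in a frame. In the RP scheme $\tau_{\mathrm{RP}}$ of them are pilot symbols, with $K\le\tau_{\mathrm{RP}}<\tau_{\mathrm{SP}}$. Let $\tau=\tau_{\mathrm{RP}}$ for RP and $\tau=\tau_{\mathrm{SP}}$ for SP. There is a set of $\tau$ orthogonal pilots. The CUEs use $K$ distinct pilots, and every V2V transmitter picks its pilot uniformly at random, independently of the others. $\chi_{ud}\in\{0,1\}$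 is the indicator that V2V transmitter $(u,d)$ uses the same pilot as CUE $k$. Thus $\chi_{ud}=1$ with probability $1/\tau$. $\mathbb E_\chi$ denotes the expectation over the pilot allocation. **Powers and fading.** $p^{\mathrm V}_{ud},q^{\mathrm V}_{ud}>0$ are the data-signal and pilot powers of V2V transmitter $(u,d)$. $p^{\mathrm C}_k,q^{\mathrm C}_k>0$ are those of CUE $k$. The large-scale fading coefficients are $\beta^{\mathrm{C2B}}_k=\theta(d^{\mathrm{C2B}}_k)^{-\alpha}$ (from CUE $k$ to the BS) and $\beta^{\mathrm{V2B}}_{ud}=\theta(d^{\mathrm{V2B}}_{ud})^{-\alpha}$ (from V2V transmitter $(u,d)$ to the BS), where the $d$'s are positive distances and $\theta,\alpha>0$ are constants. **SINR (large-antenna expressions).** The SINR of CUE $k$ is, for RP, $$\gamma^{\mathrm C}_k=\frac{p^{\mathrm C}_k(\beta^{\mathrm{C2B}}_k)^2}{\sum_{u=1}^4\sum_{d=1}^{D_u}\chi_{ud}\,p^{\mathrm V}_{ud}\frac{q^{\mathrm V}_{ud}}{q^{\mathrm C}_k}(\beta^{\mathrm{V2B}}_{ud})^2},$$ and, for SP, $$\gamma^{\mathrm C}_k=\frac{p^{\mathrm C}_k(\beta^{\mathrm{C2B}}_k)^2}{\sum_{u=1}^4\sum_{d=1}^{D_u}\chi_{ud}\,p^{\mathrm V}_{ud}\frac{q^{\mathrm V}_{ud}}{q^{\mathrm C}_k}(\beta^{\mathrm{V2B}}_{ud})^2+\sum_{k'=1}^K\frac{(p^{\mathrm C}_{k'})^2}{\tau_{\mathrm{SP}}q^{\mathrm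 C}_k}(\beta^{\mathrm{C2B}}_{k'})^2+\sum_{u=1}^4\sum_{d=1}^{D_u}\frac{(p^{\mathrm V}_{ud})^2}{\tau_{\mathrm{SP}}q^{\mathrm C}_k}(\beta^{\mathrm{V2B}}_{ud})^2}.$$ Convention: a ratio with positive numerator and zero denominator equals $+\infty$, and expectations are taken in $[0,+\infty]$. **Worst case used in (2).** $P^{\mathrm V}_{\max},P^{\mathrm C}_{\max}>0$ are the maximum powers and $\psi=P^{\mathrm C}_{\max}/P^{\mathrm V}_{\max}$. For RP: $p^{\mathrm V}_{ud}=q^{\mathrm V}_{ud}=P^{\mathrm V}_{\max}$ and $p^{\mathrm C}_k=q^{\mathrm C}_k=P^{\mathrm C}_{\max}$ for all $u,d,k$. For SP: $p^{\mathrm V}_{ud}=q^{\mathrm V}_{ud}=P^{\mathrm V}_{\max}/2$ and $p^{\mathrm C}_k=q^{\mathrm C}_k=P^{\mathrm C}_{\max}/2$ for all $u,d,k$. **Randomness averaged over in (2).** $\rho_u>0$ is the average vehicle density of road $u$, and $D_u$ is Poisson with mean $\rho_uS_{\mathrm R}/2$. The distances are random (vehicles uniform on the roads, CUEs uniform on the sidewalk of the block). The $d^{\mathrm{C2B}}_{k'}$, $k'=1,\dots,K$, are i.i.d., the $d^{\mathrm{V2B}}_{ud}$ are identically distributed, and the families $(d^{\mathrm{C2B}}_{k'})$, $(d^{\mathrm{V2B}}_{ud})$ and $(D_u)$ are mutually independent. The following finite moments define the constants $\Omega$: $\mathbb E[(d^{\mathrm{C2B}}_{k'})^{-2\alpha}]=\Omega^{\mathrm{C2B}}_{\mathrm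 N}$, $\mathbb E[(d^{\mathrm{C2B}}_{k'})^{2\alpha}]=\Omega^{\mathrm{C2B}}_{\mathrm P}$, and $\mathbb E[(d^{\mathrm{V2B}}_{ud})^{-2\alpha}]=\Omega^{\mathrm{V2B}}_{\mathrm N}$. *)

theory Defs
  imports "HOL-Probability.Probability"
begin

datatype scheme = RP | SP

definition num_pilots :: "scheme \<Rightarrow> nat \<Rightarrow> nat \<Rightarrow> nat" where
  "num_pilots s \<tau>RP \<tau>SP = (case s of RP \<Rightarrow> \<tau>RP | SP \<Rightarrow> \<tau>SP)"

definition fading :: "real \<Rightarrow> real \<Rightarrow> real \<Rightarrow> real" where
  "fading \<theta> \<alpha> d = \<theta> * d powr (- \<alpha>)"


section \<open>Pilot allocation, SINR and its lower bound\<close>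

text \<open>
  Roads are numbered by \<open>u \<in> {1..4}\<close>, the V2V pairs of road \<open>u\<close> by \<open>d \<in> {1..D u}\<close>, the CUEs by
  \<open>{1..K}\<close>, and the orthogonal pilots by \<open>{1..\<tau>}\<close>.  The pilots of all V2V transmitters are
  independent and uniformly distributed; the value 0 outside the finite index set is a dummy.
\<close>

definition V2V_pairs :: "(nat \<Rightarrow> nat) \<Rightarrow> (nat \<times> nat) set" where
  "V2V_pairs D = (SIGMA u:{1..4}. {1..D u})"

definition pilot_pmf :: "nat \<Rightarrow> (nat \<Rightarrow> nat) \<Rightarrow> (nat \<times> nat \<Rightarrow> nat) pmf" where
  "pilot_pmf \<tau> D = Pi_pmf (V2V_pairs D) 0 (\<lambda>_. pmf_of_set {1..\<tau>})"

definition same_pilot :: "(nat \<Rightarrow> nat) \<Rightarrow> nat \<Rightarrow> (nat \<times> nat \<Rightarrow> nat) \<Rightarrow> nat \<Rightarrow> nat \<Rightarrow> real" where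
  "same_pilot c k \<pi> u d = of_bool (\<pi> (u, d) = c k)"

text \<open>
  SINRs are ratios in \<^typ>\<open>ennreal\<close>, where \<open>x / 0 = \<top>\<close> for \<open>x > 0\<close>.  Numerators and denominators
  are nonnegative reals in all uses, so the truncation by \<^const>\<open>ennreal\<close> has no effect.
\<close>

definition sinr_CUE ::
  "scheme \<Rightarrow> nat \<Rightarrow> nat \<Rightarrow> (nat \<Rightarrow> nat) \<Rightarrow> (nat \<Rightarrow> nat \<Rightarrow> real) \<Rightarrow>
   (nat \<Rightarrow> nat \<Rightarrow> real) \<Rightarrow> (nat \<Rightarrow> nat \<Rightarrow> real) \<Rightarrow> (nat \<Rightarrow> real) \<Rightarrow> (nat \<Rightarrow> real) \<Rightarrow>
   (nat \<Rightarrow> nat \<Rightarrow> real) \<Rightarrow> (nat \<Rightarrow> real) \<Rightarrow> nat \<Rightarrow> ennreal"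
where
  "sinr_CUE s \<tau>SP K D chi pV qV pC qC \<beta>V \<beta>C k =
     ennreal (pC k * (\<beta>C k)\<^sup>2) /
     ennreal
       (case s of
          RP \<Rightarrow>
            (\<Sum>u=1..4. \<Sum>d=1..D u. chi u d * pV u d * (qV u d / qC k) * (\<beta>V u d)\<^sup>2)
        | SP \<Rightarrow>
            (\<Sum>u=1..4. \<Sum>d=1..D u. chi u d * pV u d * (qV u d / qC k) * (\<beta>V u d)\<^sup>2)
          + (\<Sum>k'=1..K. (pC k')\<^sup>2 / (real \<tau>SP * qC k) * (\<beta>C k')\<^sup>2)
          + (\<Sum>u=1..4. \<Sum>d=1..D u. (pV u d)\<^sup>2 / (real \<tau>SP * qC k) * (\<beta>V u d)\<^sup>2))"

definition pilot_mean_sinr ::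
  "scheme \<Rightarrow> nat \<Rightarrow> nat \<Rightarrow> nat \<Rightarrow> (nat \<Rightarrow> nat) \<Rightarrow> (nat \<Rightarrow> nat) \<Rightarrow>
   (nat \<Rightarrow> nat \<Rightarrow> real) \<Rightarrow> (nat \<Rightarrow> nat \<Rightarrow> real) \<Rightarrow> (nat \<Rightarrow> real) \<Rightarrow> (nat \<Rightarrow> real) \<Rightarrow>
   (nat \<Rightarrow> nat \<Rightarrow> real) \<Rightarrow> (nat \<Rightarrow> real) \<Rightarrow> nat \<Rightarrow> ennreal"
where
  "pilot_mean_sinr s \<tau>RP \<tau>SP K c D pV qV pC qC \<beta>V \<beta>C k =
     (\<integral>\<^sup>+ \<pi>. sinr_CUE s \<tau>SP K D (same_pilot c k \<pi>) pV qV pC qC \<beta>V \<beta>C k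
        \<partial>measure_pmf (pilot_pmf (num_pilots s \<tau>RP \<tau>SP) D))"

definition sinr_bound ::
  "scheme \<Rightarrow> nat \<Rightarrow> nat \<Rightarrow> nat \<Rightarrow> (nat \<Rightarrow> nat) \<Rightarrow>
   (nat \<Rightarrow> nat \<Rightarrow> real) \<Rightarrow> (nat \<Rightarrow> nat \<Rightarrow> real) \<Rightarrow> (nat \<Rightarrow> real) \<Rightarrow> (nat \<Rightarrow> real) \<Rightarrow>
   (nat \<Rightarrow> nat \<Rightarrow> real) \<Rightarrow> (nat \<Rightarrow> real) \<Rightarrow> nat \<Rightarrow> ennreal"
where
  "sinr_bound s \<tau>RP \<tau>SP K D pV qV pC qC \<beta>V \<beta>C k =
     (case s of
        RP \<Rightarrow>
          ennreal (real \<tau>RP * pC k * qC k * (\<beta>C k)\<^sup>2) /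
          ennreal (\<Sum>u=1..4. \<Sum>d=1..D u. pV u d * qV u d * (\<beta>V u d)\<^sup>2)
      | SP \<Rightarrow>
          ennreal (real \<tau>SP * pC k * qC k * (\<beta>C k)\<^sup>2) /
          ennreal
            ((\<Sum>u=1..4. \<Sum>d=1..D u. pV u d * qV u d * (\<beta>V u d)\<^sup>2)
           + (\<Sum>k'=1..K. (pC k')\<^sup>2 * (\<beta>C k')\<^sup>2)
           + (\<Sum>u=1..4. \<Sum>d=1..D u. (pV u d)\<^sup>2 * (\<beta>V u d)\<^sup>2)))"


section \<open>Averaging over vehicle density and large-scale fading\<close>

definition worst_power :: "scheme \<Rightarrow> real \<Rightarrow> real" where
  "worst_power s P = (case s of RP \<Rightarrow> P | SP \<Rightarrow> P / 2)"

definition mean_sinr_bound ::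
  "scheme \<Rightarrow> nat \<Rightarrow> nat \<Rightarrow> nat \<Rightarrow> real \<Rightarrow> (nat \<Rightarrow> real) \<Rightarrow> real \<Rightarrow> real \<Rightarrow> real \<Rightarrow> real \<Rightarrow> ennreal"
where
  "mean_sinr_bound s \<tau>RP \<tau>SP K \<psi> \<rho> S \<Omega>VN \<Omega>CN \<Omega>CP =
     (case s of
        RP \<Rightarrow>
          ennreal (2 * real \<tau>RP * \<psi>\<^sup>2) / ennreal (\<Sum>u=1..4. \<rho> u * S * \<Omega>VN * \<Omega>CP)
      | SP \<Rightarrow>
          ennreal (real \<tau>SP * \<psi>\<^sup>2) /
          ennreal ((\<Sum>u=1..4. \<rho> u * S * \<Omega>VN * \<Omega>CP) + real K * \<psi>\<^sup>2 * \<Omega>CN * \<Omega>CP))"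

text \<open>
  The base station is the origin, and the block is the square \<open>[-h,h] \<times> [-h,h]\<close>.  Road 1 is a
  rectangle lying along the whole upper side of the block, and roads 2, 3, 4 are its successive
  quarter turns about the base station.  The abscissa \<open>x0\<close> of the left end of road 1 is
  a free parameter, so that no choice is made about which roads contain the crossings at the corners.
\<close>

definition bs_dist :: "real \<times> real \<Rightarrow> real" where
  "bs_dist x = dist x (0, 0)"

definition quarter_turn :: "real \<times> real \<Rightarrow> real \<times> real" where
  "quarter_turn = (\<lambda>(x, y). (- y, x))"

definition road :: "real \<Rightarrow> real \<Rightarrow> real \<Rightarrow> real \<Rightarrow> nat \<Rightarrow> (real \<times> real) set" where
  "road h x0 len wid u = (quarter_turn ^^ (u - 1)) ` ({x0..x0 + len} \<times> {h..h + wid})"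

text \<open>
  The sidewalk is the strip of width \<open>w\<close> along the inner border of the block.  The case \<open>w = 0\<close>
  stands for a sidewalk idealised as the border line, with the uniform law with respect to length:
  one of the four sides is chosen uniformly, then a point uniformly on that side.
\<close>

definition sidewalk_law :: "real \<Rightarrow> real \<Rightarrow> (real \<times> real) measure" where
  "sidewalk_law h w =
     (if w = 0
      then distr (measure_pmf (pmf_of_set {0..<4::nat}) \<Otimes>\<^sub>M uniform_measure lborel {- h..h}) borel
             (\<lambda>(j, t). (quarter_turn ^^ j) (t, h))
      else uniform_measure lborel
             {(x, y). h - w \<le> max \<bar>x\<bar> \<bar>y\<bar> \<and> max \<bar>x\<bar> \<bar>y\<bar> \<le> h})"

definition family_events :: "'w measure \<Rightarrow> 'b measure \<Rightarrow> ('i \<Rightarrow> 'w \<Rightarrow> 'b) \<Rightarrow> 'i set \<Rightarrow> 'w set set" where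
  "family_events M N X I =
     sigma_sets (space M) (\<Union>i\<in>I. {X i -` B \<inter> space M | B. B \<in> sets N})"

datatype rv_family = CUE_distances | V2V_distances | Pair_numbers

text \<open>
  The \<open>K\<close> CUEs are placed at \<open>posC 1, \<dots>, posC K\<close>, and \<open>posV u 1, posV u 2, \<dots>\<close> is an infinite
  supply of V2V transmitter positions on road \<open>u\<close>, of which the first \<open>D u\<close> are used.  Within the
  families of V2V distances and of pair numbers no independence is assumed.
\<close>

locale random_deployment = prob_space M
  for M :: "'w measure" +
  fixes K :: nat and \<alpha> len wid h x0 w :: real
    and \<rho> :: "nat \<Rightarrow> real"
    and D :: "nat \<Rightarrow> 'w \<Rightarrow> nat"
    and posV :: "nat \<Rightarrow> nat \<Rightarrow> 'w \<Rightarrow> real \<times> real"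
    and posC :: "nat \<Rightarrow> 'w \<Rightarrow> real \<times> real"
    and \<Omega>VN \<Omega>CN \<Omega>CP :: real
  assumes dims: "0 < len" "0 < wid" "0 < h" "0 \<le> w" "w < h"
    and road_along_block: "x0 \<le> - h" "h \<le> x0 + len"
    and density_pos: "\<And>u. u \<in> {1..4} \<Longrightarrow> 0 < \<rho> u"
    and D_measurable: "\<And>u. u \<in> {1..4} \<Longrightarrow> D u \<in> measurable M (count_space UNIV)"
    and D_Poisson: "\<And>u. u \<in> {1..4} \<Longrightarrow>
      distr M (count_space UNIV) (D u) = measure_pmf (poisson_pmf (\<rho> u * (len * wid) / 2))"
    and posV_measurable: "\<And>u d. u \<in> {1..4} \<Longrightarrow> 1 \<le> d \<Longrightarrow> posV u d \<in> borel_measurable M"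
    and posV_uniform: "\<And>u d. u \<in> {1..4} \<Longrightarrow> 1 \<le> d \<Longrightarrow>
      distr M borel (posV u d) = uniform_measure lborel (road h x0 len wid u)"
    and posC_measurable: "\<And>j. j \<in> {1..K} \<Longrightarrow> posC j \<in> borel_measurable M"
    and posC_uniform: "\<And>j. j \<in> {1..K} \<Longrightarrow> distr M borel (posC j) = sidewalk_law h w"
    and V2V_distances_pos: "\<And>u d \<omega>. u \<in> {1..4} \<Longrightarrow> 1 \<le> d \<Longrightarrow> \<omega> \<in> space M \<Longrightarrow>
      0 < bs_dist (posV u d \<omega>)"
    and CUE_distances_pos: "\<And>j \<omega>. j \<in> {1..K} \<Longrightarrow> \<omega> \<in> space M \<Longrightarrow> 0 < bs_dist (posC j \<omega>)"
    and V2V_distances_identical: "\<And>u d u' d'. u \<in> {1..4} \<Longrightarrow> 1 \<le> d \<Longrightarrow> u' \<in> {1..4} \<Longrightarrow> 1 \<le> d' \<Longrightarrow>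
      distr M borel (\<lambda>\<omega>. bs_dist (posV u d \<omega>)) = distr M borel (\<lambda>\<omega>. bs_dist (posV u' d' \<omega>))"
    and CUE_distances_identical: "\<And>i j. i \<in> {1..K} \<Longrightarrow> j \<in> {1..K} \<Longrightarrow>
      distr M borel (\<lambda>\<omega>. bs_dist (posC i \<omega>)) = distr M borel (\<lambda>\<omega>. bs_dist (posC j \<omega>))"
    and CUE_distances_indep: "indep_vars (\<lambda>_. borel) (\<lambda>j \<omega>. bs_dist (posC j \<omega>)) {1..K}"
    and families_indep:
      "indep_sets
        (\<lambda>f. case f of
           CUE_distances \<Rightarrow> family_events M borel (\<lambda>j \<omega>. bs_dist (posC j \<omega>)) {1..K}
         | V2V_distances \<Rightarrow>
             family_events M borel (\<lambda>(u, d) \<omega>. bs_dist (posV u d \<omega>)) ({1..4} \<times> {1..})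
         | Pair_numbers \<Rightarrow> family_events M (count_space UNIV) D {1..4})
        UNIV"
    and moment_VN: "\<And>u d. u \<in> {1..4} \<Longrightarrow> 1 \<le> d \<Longrightarrow>
      integrable M (\<lambda>\<omega>. bs_dist (posV u d \<omega>) powr (- 2 * \<alpha>)) \<and>
      expectation (\<lambda>\<omega>. bs_dist (posV u d \<omega>) powr (- 2 * \<alpha>)) = \<Omega>VN"
    and moment_CN: "\<And>j. j \<in> {1..K} \<Longrightarrow>
      integrable M (\<lambda>\<omega>. bs_dist (posC j \<omega>) powr (- 2 * \<alpha>)) \<and>
      expectation (\<lambda>\<omega>. bs_dist (posC j \<omega>) powr (- 2 * \<alpha>)) = \<Omega>CN"
    and moment_CP: "\<And>j. j \<in> {1..K} \<Longrightarrow>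
      integrable M (\<lambda>\<omega>. bs_dist (posC j \<omega>) powr (2 * \<alpha>)) \<and>
      expectation (\<lambda>\<omega>. bs_dist (posC j \<omega>) powr (2 * \<alpha>)) = \<Omega>CP"

end

theory Submission
  imports Defs
begin

text \<open>
  Both parts are Jensen's inequality \<open>E[a / Y] \<ge> a / E[Y]\<close> in \<^typ>\<open>ennreal\<close>.  In part (1), \<open>Y\<close> is
  the interference, whose pilot mean replaces each collision indicator by \<open>1 / \<tau>\<close>.  In part (2), the
  bound is first rewritten as \<open>a / Y\<close> with a constant numerator, by moving the fading of CUE \<open>k\<close> into
  the denominator; then \<open>E[Y]\<close> factorises by independence, and \<open>E[D u] = \<rho> u * S / 2\<close>.  In the
  SP sum over the CUEs, the term \<open>k' = k\<close> is not a product of independent factors but equals 1,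
  which is at most \<open>\<Omega>CN * \<Omega>CP\<close>, again by Jensen's inequality.
\<close>

section \<open>Jensen's inequality for reciprocals in the extended nonnegative reals\<close>

text \<open>The tangent of \<open>y \<mapsto> a / y\<close> at \<open>m\<close>, with its negative term moved to the right because
  subtraction on \<^typ>\<open>ennreal\<close> is truncated.\<close>
lemma ennreal_divide_tangent:
  fixes a m y :: ennreal
  assumes "a < \<top>" "m \<noteq> 0" "m < \<top>"
  shows "a / m + a / m \<le> a / y + a / m / m * y"
proof (cases "a = 0")
  case False
  consider "y = 0" | "y = \<top>" | "y \<noteq> 0" "y \<noteq> \<top>" by blast
  then show ?thesis
  proof cases
    case 1
    then show ?thesis using False by (simp add: ennreal_divide_eq_top_iff divide_ennreal_def ennreal_mult_top)
  next
    case 2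
    have "a / m / m \<noteq> 0"
      using False assms by (simp add: ennreal_divide_eq_0_iff)
    then show ?thesis using 2 by (simp add: ennreal_mult_top)
  next
    case 3
    obtain a' where a': "a = ennreal a'" "0 < a'"
      using assms(1) False by (cases a) (auto simp: less_le)
    obtain m' where m': "m = ennreal m'" "0 < m'"
      using assms by (cases m) (auto simp: less_le)
    obtain y' where y': "y = ennreal y'" "0 < y'"
      using 3 by (cases y) (auto simp: less_le)
    \<comment> \<open>The gap between \<open>a' / y\<close> and its tangent at \<open>m'\<close> is
      a multiple of a square, which gives the inequality on positive reals.\<close>
    have "0 \<le> a' * (y' - m')\<^sup>2 / (m'\<^sup>2 * y')"
      using a' y' by simp
    also have "\<dots> = a' / y' + a' / m' / m' * y' - (a' / m' + a' / m')"
      using m' y' by (simp add: field_simps power2_eq_square)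
    finally have "a' / m' + a' / m' \<le> a' / y' + a' / m' / m' * y'" by simp
    then show ?thesis
      using a' m' y'
      by (simp add: divide_ennreal flip: ennreal_plus ennreal_mult)
  qed
qed (simp add: divide_ennreal_def)

text \<open>Integrate the tangent inequality at the mean \<open>m\<close> of \<open>Y\<close>: its
  linear term integrates to \<open>a / m\<close>, which cancels one of the two copies on the left.
  The tangent exists only for positive finite \<open>m\<close>. If \<open>m\<close> is infinite the
  left side is 0, and if \<open>m = 0\<close> then \<open>Y\<close> vanishes almost everywhere and
  both sides agree.\<close>

lemma (in prob_space) divide_nn_integral_le:
  fixes a :: ennreal
  assumes [measurable]: "Y \<in> borel_measurable M" and "a < \<top>"
  shows "a / (\<integral>\<^sup>+\<omega>. Y \<omega> \<partial>M) \<le> (\<integral>\<^sup>+\<omega>. a / Y \<omega> \<partial>M)"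
proof -
  define m where "m = (\<integral>\<^sup>+\<omega>. Y \<omega> \<partial>M)"
  consider "m = \<top>" | "m = 0" | "m \<noteq> 0" "m < \<top>"
    using top.not_eq_extremum by blast
  then have "a / m \<le> (\<integral>\<^sup>+\<omega>. a / Y \<omega> \<partial>M)"
  proof cases
    case 1
    then show ?thesis by (simp add: divide_ennreal_def)
  next
    case 2
    then have "AE \<omega> in M. Y \<omega> = 0"
      unfolding m_def by (subst (asm) nn_integral_0_iff_AE) auto
    then have "(\<integral>\<^sup>+\<omega>. a / Y \<omega> \<partial>M) = (\<integral>\<^sup>+\<omega>. a / m \<partial>M)"
      using 2 by (intro nn_integral_cong_AE) auto
    then show ?thesis by (simp add: emeasure_space_1)
  next
    case 3
    \<comment> \<open>Cancelling \<open>a / m\<close> from both sides at the end is sound only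
      because it is finite.\<close>
    have fin: "a / m < \<top>"
      using 3 assms(2) by (simp add: ennreal_divide_eq_top_iff flip: less_top)
    have "a / m + a / m = (\<integral>\<^sup>+\<omega>. a / m + a / m \<partial>M)"
      by (simp add: emeasure_space_1)
    also have "\<dots> \<le> (\<integral>\<^sup>+\<omega>. a / Y \<omega> + a / m / m * Y \<omega> \<partial>M)"
      using 3 assms(2) by (intro nn_integral_mono ennreal_divide_tangent)
    also have "\<dots> = (\<integral>\<^sup>+\<omega>. a / Y \<omega> \<partial>M) + a / m / m * m"
      by (subst nn_integral_add) (auto simp: nn_integral_cmult m_def)
    also have "a / m / m * m = a / m"
      using 3 by (subst ennreal_divide_times) simp
    finally show ?thesis
      using fin by (simp flip: less_top)
  qed
  then show ?thesis by (simp add: m_def)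
qed

section \<open>Quotients of extended nonnegative reals\<close>

lemma inverse_antimono_ennreal:
  fixes x y :: ennreal
  assumes "x \<le> y"
  shows "inverse y \<le> inverse x"
proof (cases "x = 0 \<or> y = \<top>")
  case False
  with assms obtain a b where "x = ennreal a" "0 < a" "y = ennreal b" "a \<le> b"
    by (cases x; cases y) (auto simp: less_le top_unique)
  then show ?thesis by (simp add: inverse_ennreal)
qed auto

text \<open>The case \<open>b = 0\<close> has to be covered, since the denominator for RP vanishes
  when all roads are empty. Both quotients are then infinite if \<open>a\<close> is positive, and
  both are 0 if \<open>a = 0\<close>.\<close>

lemma ennreal_divide_cancel:
  assumes "0 < t" "0 \<le> a" "0 \<le> b"
  shows "ennreal (t * a) / ennreal (t * b) = ennreal a / ennreal b"
proof (cases "b = 0")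
  case True
  then show ?thesis using assms by (cases "a = 0") (auto simp: divide_ennreal_def ennreal_mult_top)
next
  case False
  then show ?thesis using assms by (simp add: divide_ennreal)
qed

section \<open>Averaging over the pilot allocation\<close>

lemma nn_integral_pmf_eq_expectation:
  fixes f :: "'a \<Rightarrow> real"
  assumes "finite (set_pmf p)" "\<And>x. 0 \<le> f x"
  shows "(\<integral>\<^sup>+x. ennreal (f x) \<partial>measure_pmf p) = ennreal (measure_pmf.expectation p f)"
  using assms by (intro nn_integral_eq_integral integrable_measure_pmf_finite) auto

lemma finite_V2V_pairs: "finite (V2V_pairs D)"
  by (simp add: V2V_pairs_def)

text \<open>Allocations of positive probability take the dummy value 0 outside the finite set of
  pairs and one of finitely many pilots on it. Finite support makes every real function of the
  allocation integrable.\<close>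

lemma finite_set_pilot_pmf:
  assumes "0 < \<tau>"
  shows "finite (set_pmf (pilot_pmf \<tau> D))"
  unfolding pilot_pmf_def using assms
  by (subst set_Pi_pmf) (auto simp: finite_V2V_pairs intro!: finite_PiE_dflt)

text \<open>The component of the allocation at a V2V pair is uniform on the pilots, so it hits the
  single pilot \<open>c k\<close> with probability \<open>1 / \<tau>\<close>.\<close>

lemma expectation_same_pilot:
  assumes "u \<in> {1..4}" "d \<in> {1..D u}" "c k \<in> {1..\<tau>}"
  shows "measure_pmf.expectation (pilot_pmf \<tau> D) (\<lambda>\<pi>. same_pilot c k \<pi> u d) = 1 / real \<tau>"
proof -
  have "(u, d) \<in> V2V_pairs D" using assms by (auto simp: V2V_pairs_def)
  then have "map_pmf (\<lambda>\<pi>. \<pi> (u, d)) (pilot_pmf \<tau> D) = pmf_of_set {1..\<tau>}"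
    by (simp add: pilot_pmf_def Pi_pmf_component finite_V2V_pairs)
  from this[symmetric] have "measure_pmf.expectation (pilot_pmf \<tau> D) (\<lambda>\<pi>. same_pilot c k \<pi> u d)
      = measure_pmf.expectation (pmf_of_set {1..\<tau>}) (\<lambda>i. of_bool (i = c k))"
    by (simp only: integral_map_pmf same_pilot_def)
  also have "\<dots> = (\<Sum>i\<in>{1..\<tau>}. of_bool (i = c k)) / real \<tau>"
    using assms by (subst integral_pmf_of_set) auto
  also have "(\<Sum>i\<in>{1..\<tau>}. of_bool (i = c k)) = (1::real)"
    using assms by (simp add: of_bool_def)
  finally show ?thesis .
qed

text \<open>Linearity of expectation; \<open>z\<close> collects the interference that does not
  depend on the pilots. Nonnegativity allows the passage between the integral in
  \<open>ennreal\<close> and the real expectation.\<close>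

lemma pilot_mean_interference:
  fixes f :: "nat \<Rightarrow> nat \<Rightarrow> real"
  assumes "c k \<in> {1..\<tau>}" "\<And>u d. u \<in> {1..4} \<Longrightarrow> d \<in> {1..D u} \<Longrightarrow> 0 \<le> f u d" "0 \<le> z"
  shows "(\<integral>\<^sup>+\<pi>. ennreal ((\<Sum>u=1..4. \<Sum>d=1..D u. same_pilot c k \<pi> u d * f u d) + z)
            \<partial>measure_pmf (pilot_pmf \<tau> D))
    = ennreal ((\<Sum>u=1..4. \<Sum>d=1..D u. f u d) / real \<tau> + z)"
proof -
  have \<tau>: "0 < \<tau>" using assms by auto
  note int = integrable_measure_pmf_finite[OF finite_set_pilot_pmf[OF \<tau>]]
  have "(\<integral>\<^sup>+\<pi>. ennreal ((\<Sum>u=1..4. \<Sum>d=1..D u. same_pilot c k \<pi> u d * f u d) + z)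
            \<partial>measure_pmf (pilot_pmf \<tau> D))
    = ennreal (measure_pmf.expectation (pilot_pmf \<tau> D)
        (\<lambda>\<pi>. (\<Sum>u=1..4. \<Sum>d=1..D u. same_pilot c k \<pi> u d * f u d) + z))"
    using assms
    by (intro nn_integral_pmf_eq_expectation finite_set_pilot_pmf \<tau> add_nonneg_nonneg sum_nonneg)
      (auto simp: same_pilot_def)
  also have "measure_pmf.expectation (pilot_pmf \<tau> D)
        (\<lambda>\<pi>. (\<Sum>u=1..4. \<Sum>d=1..D u. same_pilot c k \<pi> u d * f u d) + z)
     = (\<Sum>u=1..4. \<Sum>d=1..D u. measure_pmf.expectation (pilot_pmf \<tau> D) (\<lambda>\<pi>. same_pilot c k \<pi> u d) * f u d) + z"
    by (simp add: int Bochner_Integration.integral_sum)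
  also have "(\<Sum>u=1..4. \<Sum>d=1..D u. measure_pmf.expectation (pilot_pmf \<tau> D) (\<lambda>\<pi>. same_pilot c k \<pi> u d) * f u d)
     = (\<Sum>u=1..4. \<Sum>d=1..D u. 1 / real \<tau> * f u d)"
    using assms(1) by (intro sum.cong refl arg_cong2[where f="(*)"] expectation_same_pilot)
  also have "\<dots> = (\<Sum>u=1..4. \<Sum>d=1..D u. f u d) / real \<tau>"
    by (simp add: sum_divide_distrib)
  finally show ?thesis .
qed

text \<open>Both schemes have an SINR of the form \<open>a / Y\<close>, with \<open>z = 0\<close>
  for RP and \<open>z\<close> the pilot-independent interference for SP. The claimed bound is
  exactly \<open>a\<close> divided by the mean of \<open>Y\<close>, so Jensen's inequality
  applies.\<close>

lemma sinr_bound_le_pilot_mean_sinr: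
  fixes c D :: "nat \<Rightarrow> nat" and pV qV \<beta>V :: "nat \<Rightarrow> nat \<Rightarrow> real" and pC qC \<beta>C :: "nat \<Rightarrow> real"
  assumes ck: "c k \<in> {1..num_pilots s \<tau>RP \<tau>SP}"
    and pq: "\<And>u d. u \<in> {1..4} \<Longrightarrow> d \<in> {1..D u} \<Longrightarrow> 0 \<le> pV u d \<and> 0 \<le> qV u d"
    and C: "0 \<le> pC k" "0 < qC k"
  shows "sinr_bound s \<tau>RP \<tau>SP K D pV qV pC qC \<beta>V \<beta>C k
    \<le> pilot_mean_sinr s \<tau>RP \<tau>SP K c D pV qV pC qC \<beta>V \<beta>C k"
proof -
  define \<tau> where "\<tau> = num_pilots s \<tau>RP \<tau>SP"
  define f where "f u d = pV u d * (qV u d / qC k) * (\<beta>V u d)\<^sup>2" for u d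
  define z where "z = (case s of RP \<Rightarrow> 0
    | SP \<Rightarrow> (\<Sum>k'=1..K. (pC k')\<^sup>2 / (real \<tau>SP * qC k) * (\<beta>C k')\<^sup>2)
          + (\<Sum>u=1..4. \<Sum>d=1..D u. (pV u d)\<^sup>2 / (real \<tau>SP * qC k) * (\<beta>V u d)\<^sup>2))"
  define Y where "Y = (\<lambda>\<pi>. ennreal ((\<Sum>u=1..4. \<Sum>d=1..D u. same_pilot c k \<pi> u d * f u d) + z))"
  define a where "a = pC k * (\<beta>C k)\<^sup>2"
  have \<tau>: "0 < real \<tau>" using ck by (auto simp: \<tau>_def)
  have f: "0 \<le> f u d" if "u \<in> {1..4}" "d \<in> {1..D u}" for u d
    using pq[OF that] C by (simp add: f_def)
  have z: "0 \<le> z"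
    using C by (auto simp: z_def split: scheme.split intro!: add_nonneg_nonneg sum_nonneg)
  have F: "0 \<le> (\<Sum>u=1..4. \<Sum>d=1..D u. f u d) / real \<tau> + z"
    by (intro add_nonneg_nonneg divide_nonneg_nonneg sum_nonneg f z) auto
  have a: "0 \<le> a" using C by (simp add: a_def)
  have "(\<Sum>u=1..4. \<Sum>d=1..D u. f u d) = (\<Sum>u=1..4. \<Sum>d=1..D u. pV u d * qV u d * (\<beta>V u d)\<^sup>2) / qC k"
    unfolding sum_divide_distrib by (intro sum.cong refl) (simp add: f_def)
  then have sf: "real \<tau> * qC k * ((\<Sum>u=1..4. \<Sum>d=1..D u. f u d) / real \<tau>)
       = (\<Sum>u=1..4. \<Sum>d=1..D u. pV u d * qV u d * (\<beta>V u d)\<^sup>2)"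
    using \<tau> C by simp
  \<comment> \<open>Scaling by \<open>real \<tau> * qC k\<close> clears the
    \<open>1 / \<tau>\<close> left by averaging and the \<open>qC k\<close> below each interference
    term. For SP it also clears the factor \<open>real \<tau>SP * qC k\<close> in \<open>z\<close>,
    since there \<tau> is \<open>\<tau>SP\<close>.\<close>
  have "sinr_bound s \<tau>RP \<tau>SP K D pV qV pC qC \<beta>V \<beta>C k
    = ennreal ((real \<tau> * qC k) * a)
      / ennreal ((real \<tau> * qC k) * ((\<Sum>u=1..4. \<Sum>d=1..D u. f u d) / real \<tau> + z))"
  proof (cases s)
    case RP
    then have "\<tau> = \<tau>RP" "z = 0" by (auto simp: \<tau>_def num_pilots_def z_def)
    then show ?thesis
      unfolding distrib_left sf using RP by (simp add: sinr_bound_def a_def mult_ac)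
  next
    case SP
    have sV: "real \<tau> * qC k * (\<Sum>u=1..4. \<Sum>d=1..D u. (pV u d)\<^sup>2 / (real \<tau>SP * qC k) * (\<beta>V u d)\<^sup>2)
       = (\<Sum>u=1..4. \<Sum>d=1..D u. (pV u d)\<^sup>2 * (\<beta>V u d)\<^sup>2)"
      unfolding sum_distrib_left using SP \<tau> C
      by (intro sum.cong refl) (simp add: \<tau>_def num_pilots_def)
    have sC: "real \<tau> * qC k * (\<Sum>k'=1..K. (pC k')\<^sup>2 / (real \<tau>SP * qC k) * (\<beta>C k')\<^sup>2)
       = (\<Sum>k'=1..K. (pC k')\<^sup>2 * (\<beta>C k')\<^sup>2)"
      unfolding sum_distrib_left using SP \<tau> C
      by (intro sum.cong refl) (simp add: \<tau>_def num_pilots_def)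
    have sz: "real \<tau> * qC k * z = (\<Sum>k'=1..K. (pC k')\<^sup>2 * (\<beta>C k')\<^sup>2)
       + (\<Sum>u=1..4. \<Sum>d=1..D u. (pV u d)\<^sup>2 * (\<beta>V u d)\<^sup>2)"
      unfolding z_def SP scheme.case distrib_left sV sC ..
    have sa: "real \<tau> * qC k * a = real \<tau>SP * pC k * qC k * (\<beta>C k)\<^sup>2"
      by (simp add: a_def \<tau>_def num_pilots_def SP)
    show ?thesis
      unfolding distrib_left sf sz sa by (simp add: sinr_bound_def SP add.assoc)
  qed
  also have "\<dots> = ennreal a / ennreal ((\<Sum>u=1..4. \<Sum>d=1..D u. f u d) / real \<tau> + z)"
    using \<tau> C a F by (intro ennreal_divide_cancel) auto
  also have "\<dots> = ennreal a / (\<integral>\<^sup>+\<pi>. Y \<pi> \<partial>measure_pmf (pilot_pmf \<tau> D))"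
    unfolding Y_def using ck f z by (subst pilot_mean_interference) (auto simp: \<tau>_def)
  also have "\<dots> \<le> (\<integral>\<^sup>+\<pi>. ennreal a / Y \<pi> \<partial>measure_pmf (pilot_pmf \<tau> D))"
    by (intro measure_pmf.divide_nn_integral_le) auto
  also have "\<dots> = pilot_mean_sinr s \<tau>RP \<tau>SP K c D pV qV pC qC \<beta>V \<beta>C k"
    by (simp add: pilot_mean_sinr_def sinr_CUE_def Y_def f_def z_def a_def \<tau>_def add.assoc mult.assoc
        split: scheme.split)
  finally show ?thesis .
qed

section \<open>Poisson mean, moments and sums of random length\<close>

text \<open>The factor \<open>n + 1\<close> cancels against the factorial, so the terms of the mean
  from index 1 on are \<open>r * exp (- r)\<close> times the exponential series. The term at index 0
  is zero, which permits the shift back.\<close>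

lemma nn_integral_poisson_pmf:
  assumes "0 < r"
  shows "(\<integral>\<^sup>+n. of_nat n \<partial>measure_pmf (poisson_pmf r)) = ennreal r"
proof -
  have "(\<lambda>n. r * exp (- r) * (r ^ n /\<^sub>R fact n)) sums (r * exp (- r) * exp r)"
    by (intro sums_mult exp_converges)
  moreover have "r * exp (- r) * (r ^ n /\<^sub>R fact n) = real (Suc n) * pmf (poisson_pmf r) (Suc n)" for n
    using assms by (simp add: field_simps del: of_nat_Suc)
  ultimately have "(\<lambda>n. real (Suc n) * pmf (poisson_pmf r) (Suc n)) sums r"
    by (simp only: mult.assoc exp_minus_inverse mult_1_right flip: exp_add) simp
  then have *: "(\<lambda>n. real n * pmf (poisson_pmf r) n) sums r"
    by (subst (asm) sums_Suc_iff) simp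
  have "(\<integral>\<^sup>+n. of_nat n \<partial>measure_pmf (poisson_pmf r))
      = (\<Sum>n. ennreal (real n * pmf (poisson_pmf r) n))"
    by (subst nn_integral_measure_pmf, subst nn_integral_count_space_nat)
      (simp add: ennreal_mult ennreal_of_nat_eq_real_of_nat mult.commute)
  also have "\<dots> = ennreal r"
    using * by (subst suminf_ennreal2) (auto simp: sums_iff)
  finally show ?thesis .
qed

text \<open>Transfers the moment assumptions to integrals in \<open>ennreal\<close>; the second
  conclusion supplies the signs of the constants \<Omega>.\<close>

lemma (in prob_space) nn_integral_of_moment:
  fixes f :: "'a \<Rightarrow> real"
  assumes "integrable M f \<and> expectation f = m" "\<And>\<omega>. 0 \<le> f \<omega>"
  shows "(\<integral>\<^sup>+\<omega>. ennreal (f \<omega>) \<partial>M) = ennreal m" "0 \<le> m"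
  using assms by (auto simp: nn_integral_eq_integral)

text \<open>Turns a sum with a random number of terms into a series with a fixed range, so that it
  can be integrated termwise and the length enters only through indicators. Index \<open>d\<close>
  of the series stands for pair \<open>Suc d\<close>.\<close>

lemma sum_atLeast1_atMost_eq_suminf:
  fixes f :: "nat \<Rightarrow> ennreal"
  shows "(\<Sum>d=1..n. f d) = (\<Sum>d. of_bool (d < n) * f (Suc d))"
proof -
  have "(\<Sum>d. of_bool (d < n) * f (Suc d)) = (\<Sum>d<n. of_bool (d < n) * f (Suc d))"
    by (intro suminf_finite) auto
  also have "\<dots> = (\<Sum>d<n. f (Suc d))" by simp
  also have "\<dots> = (\<Sum>d=1..n. f d)"
    by (simp add: sum.atLeast1_atMost_eq)
  finally show ?thesis ..
qed

text \<open>The length takes countably many values, and for each of them the sum is a finite sum of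
  measurable functions. The type is kept general because both real and \<open>ennreal\<close>
  summands occur.\<close>

lemma borel_measurable_sum_random_length:
  fixes f :: "nat \<Rightarrow> 'a \<Rightarrow> 'b :: {second_countable_topology, topological_comm_monoid_add}"
  assumes "N \<in> measurable M (count_space UNIV)" "\<And>d. 1 \<le> d \<Longrightarrow> f d \<in> borel_measurable M"
  shows "(\<lambda>\<omega>. \<Sum>d=1..N \<omega>. f d \<omega>) \<in> borel_measurable M"
  by (rule measurable_compose_countable[where f = "\<lambda>n \<omega>. \<Sum>d=1..n. f d \<omega>", OF _ assms(1)])
    (auto intro!: borel_measurable_sum assms(2))

section \<open>Expected interference in a random deployment\<close>

context random_deployment
begin

abbreviation "dC j \<omega> \<equiv> bs_dist (posC j \<omega>)"
abbreviation "dV u d \<omega> \<equiv> bs_dist (posV u d \<omega>)"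

lemma measurable_bs_dist: "bs_dist \<in> borel_measurable borel"
  unfolding bs_dist_def by measurable

lemma dC_measurable: "j \<in> {1..K} \<Longrightarrow> dC j \<in> borel_measurable M"
  by (rule measurable_compose[OF posC_measurable measurable_bs_dist])

lemma dV_measurable: "u \<in> {1..4} \<Longrightarrow> 1 \<le> d \<Longrightarrow> dV u d \<in> borel_measurable M"
  by (rule measurable_compose[OF posV_measurable measurable_bs_dist])

lemma nn_integral_pair_number:
  assumes "u \<in> {1..4}"
  shows "(\<integral>\<^sup>+\<omega>. of_nat (D u \<omega>) \<partial>M) = ennreal (\<rho> u * (len * wid) / 2)"
proof -
  have "(\<integral>\<^sup>+\<omega>. of_nat (D u \<omega>) \<partial>M) = (\<integral>\<^sup>+n. of_nat n \<partial>distr M (count_space UNIV) (D u))"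
    by (intro nn_integral_distr[symmetric] D_measurable assms) auto
  also have "\<dots> = ennreal (\<rho> u * (len * wid) / 2)"
    unfolding D_Poisson[OF assms]
    using density_pos[OF assms] dims by (intro nn_integral_poisson_pmf) auto
  finally show ?thesis .
qed

text \<open>Each factor depends on one member of one of the three independent families, so the
  factors are independent and the integral of the product splits.\<close>

lemma nn_integral_product_three:
  assumes j: "j \<in> {1..K}" and u: "u \<in> {1..4}" and d: "1 \<le> d"
    and [measurable]: "f \<in> borel_measurable borel" "g \<in> borel_measurable borel"
  shows "(\<integral>\<^sup>+\<omega>. f (dC j \<omega>) * (of_bool (d \<le> D u \<omega>) * g (dV u d \<omega>)) \<partial>M)
    = (\<integral>\<^sup>+\<omega>. f (dC j \<omega>) \<partial>M) * ((\<integral>\<^sup>+\<omega>. of_bool (d \<le> D u \<omega>) \<partial>M) * (\<integral>\<^sup>+\<omega>. g (dV u d \<omega>) \<partial>M))"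
proof -
  \<comment> \<open>Indexing the factors by \<open>rv_family\<close> matches the index set of
    \<open>families_indep\<close>.\<close>
  define X :: "rv_family \<Rightarrow> 'w \<Rightarrow> ennreal" where
    "X i = (case i of CUE_distances \<Rightarrow> \<lambda>\<omega>. f (dC j \<omega>) | V2V_distances \<Rightarrow> \<lambda>\<omega>. g (dV u d \<omega>)
       | Pair_numbers \<Rightarrow> \<lambda>\<omega>. of_bool (d \<le> D u \<omega>))" for i
  note [measurable] = dC_measurable[OF j] dV_measurable[OF u d] D_measurable[OF u]
  have UNIV: "(UNIV :: rv_family set) = {CUE_distances, V2V_distances, Pair_numbers}"
    using rv_family.exhaust by auto
  \<comment> \<open>A preimage under \<open>\<phi>\<close> composed with \<open>Z i\<close> is a
    preimage under \<open>Z i\<close> of a measurable set, hence a generator of the events of the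
    family.\<close>
  have gen: "{(\<lambda>\<omega>. \<phi> (Z i \<omega>)) -` A \<inter> space M | A. A \<in> sets borel} \<subseteq> family_events M N Z I"
    if "i \<in> I" "\<phi> \<in> measurable N borel" "Z i \<in> measurable M N"
    for \<phi> :: "'b \<Rightarrow> ennreal" and Z :: "'i \<Rightarrow> 'w \<Rightarrow> 'b" and N i I
  proof safe
    fix A :: "ennreal set" assume A: "A \<in> sets borel"
    have "(\<lambda>\<omega>. \<phi> (Z i \<omega>)) -` A \<inter> space M = Z i -` (\<phi> -` A \<inter> space N) \<inter> space M"
      using measurable_space[OF that(3)] by auto
    then show "(\<lambda>\<omega>. \<phi> (Z i \<omega>)) -` A \<inter> space M \<in> family_events M N Z I"
      unfolding family_events_def using that(1) measurable_sets[OF that(2) A]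
      by (intro sigma_sets.Basic) blast
  qed
  have "indep_vars (\<lambda>_. borel) X UNIV"
    unfolding indep_vars_def2
  proof
    show "\<forall>i\<in>UNIV. random_variable borel (X i)"
      by (auto simp: X_def UNIV)
    show "indep_sets (\<lambda>i. {X i -` A \<inter> space M | A. A \<in> sets borel}) UNIV"
    proof (rule indep_sets_mono_sets[OF families_indep])
      fix i :: rv_family
      show "{X i -` A \<inter> space M | A. A \<in> sets borel} \<subseteq> (case i of
           CUE_distances \<Rightarrow> family_events M borel (\<lambda>j \<omega>. dC j \<omega>) {1..K}
         | V2V_distances \<Rightarrow> family_events M borel (\<lambda>(u, d) \<omega>. dV u d \<omega>) ({1..4} \<times> {1..})
         | Pair_numbers \<Rightarrow> family_events M (count_space UNIV) D {1..4})"
      proof (cases i)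
        case CUE_distances
        then show ?thesis
          using gen[of j "{1..K}" f borel "\<lambda>j \<omega>. dC j \<omega>"] j by (simp add: X_def)
      next
        case V2V_distances
        then show ?thesis
          using gen[of "(u, d)" "{1..4} \<times> {1..}" g borel "\<lambda>(u, d) \<omega>. dV u d \<omega>"] u d
          by (simp add: X_def)
      next
        case Pair_numbers
        then show ?thesis
          using gen[of u "{1..4}" "\<lambda>n. of_bool (d \<le> n)" "count_space UNIV" D] u by (simp add: X_def)
      qed
    qed
  qed
  then have "(\<integral>\<^sup>+\<omega>. (\<Prod>i\<in>UNIV. X i \<omega>) \<partial>M) = (\<Prod>i\<in>UNIV. \<integral>\<^sup>+\<omega>. X i \<omega> \<partial>M)"
    by (intro indep_vars_nn_integral) (auto simp: UNIV)
  then show ?thesis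
    by (simp add: UNIV X_def mult_ac)
qed

text \<open>Wald's identity with an additional independent factor from CUE \<open>k\<close>: the sum
  becomes a series of terms with indicators, and each term factorises.\<close>

lemma nn_integral_V2V_interference:
  assumes k: "k \<in> {1..K}" and u: "u \<in> {1..4}"
  shows "(\<integral>\<^sup>+\<omega>. ennreal (dC k \<omega> powr (2 * \<alpha>)) * (\<Sum>d=1..D u \<omega>. ennreal (dV u d \<omega> powr (- 2 * \<alpha>))) \<partial>M)
    = ennreal (\<rho> u * (len * wid) / 2 * \<Omega>VN * \<Omega>CP)"
proof -
  note [measurable] = dC_measurable[OF k] D_measurable[OF u] dV_measurable[OF u]
  have CP: "(\<integral>\<^sup>+\<omega>. ennreal (dC k \<omega> powr (2 * \<alpha>)) \<partial>M) = ennreal \<Omega>CP" "0 \<le> \<Omega>CP"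
    using nn_integral_of_moment[OF moment_CP[OF k]] by auto
  have VN: "(\<integral>\<^sup>+\<omega>. ennreal (dV u (Suc d) \<omega> powr (- 2 * \<alpha>)) \<partial>M) = ennreal \<Omega>VN" "0 \<le> \<Omega>VN" for d
    using nn_integral_of_moment[OF moment_VN[OF u, of "Suc d"]] by auto
  have "(\<integral>\<^sup>+\<omega>. ennreal (dC k \<omega> powr (2 * \<alpha>)) * (\<Sum>d=1..D u \<omega>. ennreal (dV u d \<omega> powr (- 2 * \<alpha>))) \<partial>M)
    = (\<integral>\<^sup>+\<omega>. (\<Sum>d. ennreal (dC k \<omega> powr (2 * \<alpha>))
        * (of_bool (Suc d \<le> D u \<omega>) * ennreal (dV u (Suc d) \<omega> powr (- 2 * \<alpha>)))) \<partial>M)"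
    unfolding sum_atLeast1_atMost_eq_suminf by (simp add: Suc_le_eq)
  also have "\<dots> = (\<Sum>d. \<integral>\<^sup>+\<omega>. ennreal (dC k \<omega> powr (2 * \<alpha>))
        * (of_bool (Suc d \<le> D u \<omega>) * ennreal (dV u (Suc d) \<omega> powr (- 2 * \<alpha>))) \<partial>M)"
    by (intro nn_integral_suminf) measurable
  also have "\<dots> = (\<Sum>d. ennreal \<Omega>CP * ((\<integral>\<^sup>+\<omega>. of_bool (Suc d \<le> D u \<omega>) \<partial>M) * ennreal \<Omega>VN))"
    using nn_integral_product_three[OF k u,
        where f = "\<lambda>x. ennreal (x powr (2 * \<alpha>))" and g = "\<lambda>x. ennreal (x powr (- 2 * \<alpha>))"]
    by (simp add: CP VN[simplified])
  also have "\<dots> = ennreal \<Omega>CP * ((\<Sum>d. \<integral>\<^sup>+\<omega>. of_bool (Suc d \<le> D u \<omega>) \<partial>M) * ennreal \<Omega>VN)"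
    by simp
  \<comment> \<open>Tail-sum formula: the probabilities of \<open>Suc d \<le> D u\<close> add up to
    the mean of \<open>D u\<close>.\<close>
  also have "(\<Sum>d. \<integral>\<^sup>+\<omega>. of_bool (Suc d \<le> D u \<omega>) \<partial>M) = (\<integral>\<^sup>+\<omega>. (\<Sum>d. of_bool (Suc d \<le> D u \<omega>)) \<partial>M)"
    by (intro nn_integral_suminf[symmetric]) measurable
  also have "\<dots> = (\<integral>\<^sup>+\<omega>. of_nat (D u \<omega>) \<partial>M)"
    using sum_atLeast1_atMost_eq_suminf[of "\<lambda>_. 1"] by (simp add: Suc_le_eq)
  also have "\<dots> = ennreal (\<rho> u * (len * wid) / 2)"
    by (rule nn_integral_pair_number[OF u])
  also have "ennreal \<Omega>CP * (ennreal (\<rho> u * (len * wid) / 2) * ennreal \<Omega>VN)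
    = ennreal (\<rho> u * (len * wid) / 2 * \<Omega>VN * \<Omega>CP)"
    using CP VN density_pos[OF u] dims by (simp add: mult_ac flip: ennreal_mult)
  finally show ?thesis .
qed

text \<open>Jensen's inequality for \<open>dC k \<omega> powr (2 * \<alpha>)\<close>, whose
  reciprocal is the power with exponent \<open>- 2 * \<alpha>\<close> because distances are
  positive.\<close>

lemma one_le_moments:
  assumes k: "k \<in> {1..K}"
  shows "1 \<le> \<Omega>CN * \<Omega>CP"
proof -
  note [measurable] = dC_measurable[OF k]
  have CP: "(\<integral>\<^sup>+\<omega>. ennreal (dC k \<omega> powr (2 * \<alpha>)) \<partial>M) = ennreal \<Omega>CP" "0 \<le> \<Omega>CP"
    using nn_integral_of_moment[OF moment_CP[OF k]] by auto
  have CN: "(\<integral>\<^sup>+\<omega>. ennreal (dC k \<omega> powr (- 2 * \<alpha>)) \<partial>M) = ennreal \<Omega>CN" "0 \<le> \<Omega>CN"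
    using nn_integral_of_moment[OF moment_CN[OF k]] by auto
  have "1 / ennreal \<Omega>CP \<le> (\<integral>\<^sup>+\<omega>. 1 / ennreal (dC k \<omega> powr (2 * \<alpha>)) \<partial>M)"
    unfolding CP(1)[symmetric] by (intro divide_nn_integral_le) auto
  also have "\<dots> = (\<integral>\<^sup>+\<omega>. ennreal (dC k \<omega> powr (- 2 * \<alpha>)) \<partial>M)"
  proof (intro nn_integral_cong)
    fix \<omega> assume "\<omega> \<in> space M"
    then have "0 < dC k \<omega>" by (rule CUE_distances_pos[OF k])
    then show "1 / ennreal (dC k \<omega> powr (2 * \<alpha>)) = ennreal (dC k \<omega> powr (- 2 * \<alpha>))"
      by (simp add: powr_minus field_simps flip: ennreal_1 divide_ennreal)
  qed
  finally have *: "1 / ennreal \<Omega>CP \<le> ennreal \<Omega>CN" unfolding CN(1) .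
  \<comment> \<open>If \<open>\<Omega>CP\<close> were 0, the left side of \<open>*\<close> would be
    infinite while \<open>\<Omega>CN\<close> is finite.\<close>
  then have "0 < \<Omega>CP"
    using CP(2) by (cases "\<Omega>CP = 0") (auto simp: top_unique)
  moreover from this * have "1 / \<Omega>CP \<le> \<Omega>CN"
    using CN(2) by (simp add: divide_ennreal flip: ennreal_1)
  ultimately show ?thesis by (simp add: field_simps)
qed

text \<open>For distinct CUEs independence even gives equality. For \<open>j = k\<close> the powers
  cancel to 1, and \<open>one_le_moments\<close> takes over.\<close>

lemma nn_integral_CUE_pair_le:
  assumes k: "k \<in> {1..K}" and j: "j \<in> {1..K}"
  shows "(\<integral>\<^sup>+\<omega>. ennreal (dC k \<omega> powr (2 * \<alpha>)) * ennreal (dC j \<omega> powr (- 2 * \<alpha>)) \<partial>M)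
    \<le> ennreal (\<Omega>CN * \<Omega>CP)"
proof (cases "j = k")
  case True
  have "(\<integral>\<^sup>+\<omega>. ennreal (dC k \<omega> powr (2 * \<alpha>)) * ennreal (dC j \<omega> powr (- 2 * \<alpha>)) \<partial>M) = (\<integral>\<^sup>+\<omega>. 1 \<partial>M)"
  proof (intro nn_integral_cong)
    fix \<omega> assume "\<omega> \<in> space M"
    then have "0 < dC k \<omega>" by (rule CUE_distances_pos[OF k])
    then show "ennreal (dC k \<omega> powr (2 * \<alpha>)) * ennreal (dC j \<omega> powr (- 2 * \<alpha>)) = 1"
      by (simp add: True flip: ennreal_mult powr_add)
  qed
  also have "\<dots> \<le> ennreal (\<Omega>CN * \<Omega>CP)"
    using one_le_moments[OF k] by (simp add: emeasure_space_1)
  finally show ?thesis .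
next
  case False
  \<comment> \<open>Letting the exponent depend on the index treats both powers as one transformed
    family on \<open>{k, j}\<close>.\<close>
  define \<phi> where "\<phi> i = (\<lambda>x. ennreal (x powr (if i = k then 2 * \<alpha> else - 2 * \<alpha>)))" for i
  have "indep_vars (\<lambda>_. borel) dC {k, j}"
    using k j by (intro indep_vars_subset[OF CUE_distances_indep]) auto
  then have "indep_vars (\<lambda>_. borel) (\<lambda>i \<omega>. \<phi> i (dC i \<omega>)) {k, j}"
    by (rule indep_vars_compose2) (simp add: \<phi>_def)
  then have "(\<integral>\<^sup>+\<omega>. (\<Prod>i\<in>{k, j}. \<phi> i (dC i \<omega>)) \<partial>M) = (\<Prod>i\<in>{k, j}. \<integral>\<^sup>+\<omega>. \<phi> i (dC i \<omega>) \<partial>M)"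
    by (intro indep_vars_nn_integral) auto
  also have "\<dots> = ennreal \<Omega>CP * ennreal \<Omega>CN"
    using False nn_integral_of_moment[OF moment_CP[OF k]] nn_integral_of_moment[OF moment_CN[OF j]]
    by (simp add: \<phi>_def)
  also have "\<dots> = ennreal (\<Omega>CN * \<Omega>CP)"
    using nn_integral_of_moment[OF moment_CP[OF k]] nn_integral_of_moment[OF moment_CN[OF j]]
    by (simp add: mult.commute flip: ennreal_mult)
  finally show ?thesis using False by (simp add: \<phi>_def)
qed

text \<open>The weight \<open>g\<close> lets one estimate serve both schemes: it will be 0 for RP
  and the squared power ratio for SP. The factor 2 cancels the 1/2 in the Poisson mean.\<close>

lemma nn_integral_interference_le:
  assumes k: "k \<in> {1..K}" and g: "0 \<le> g"
  shows "(\<integral>\<^sup>+\<omega>. ennreal (2 * (dC k \<omega> powr (2 * \<alpha>) * (\<Sum>u=1..4. \<Sum>d=1..D u \<omega>. dV u d \<omega> powr (- 2 * \<alpha>)))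
       + g * (dC k \<omega> powr (2 * \<alpha>) * (\<Sum>j=1..K. dC j \<omega> powr (- 2 * \<alpha>)))) \<partial>M)
    \<le> ennreal ((\<Sum>u=1..4. \<rho> u * (len * wid) * \<Omega>VN * \<Omega>CP) + real K * g * \<Omega>CN * \<Omega>CP)"
    (is "(\<integral>\<^sup>+\<omega>. ennreal (?Y \<omega>) \<partial>M) \<le> _")
proof -
  have [measurable]: "dC j \<in> borel_measurable M" if "j \<in> {1..K}" for j
    using that by (rule dC_measurable)
  note [measurable] = dC_measurable[OF k]
  have [measurable]: "(\<lambda>\<omega>. \<Sum>d=1..D u \<omega>. ennreal (dV u d \<omega> powr (- 2 * \<alpha>))) \<in> borel_measurable M"
    if u: "u \<in> {1..4}" for u
    by (intro borel_measurable_sum_random_length D_measurable[OF u] measurable_compose[OF dV_measurable[OF u]]) auto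
  have CP0: "0 \<le> \<Omega>CP" using nn_integral_of_moment[OF moment_CP[OF k]] by auto
  have VN0: "0 \<le> \<Omega>VN" using nn_integral_of_moment[OF moment_VN[of 1 1]] by auto
  have CN0: "0 \<le> \<Omega>CN" using nn_integral_of_moment[OF moment_CN[OF k]] by auto
  define A where "A u \<omega> = ennreal (dC k \<omega> powr (2 * \<alpha>)) * (\<Sum>d=1..D u \<omega>. ennreal (dV u d \<omega> powr (- 2 * \<alpha>)))" for u \<omega>
  define B where "B j \<omega> = ennreal (dC k \<omega> powr (2 * \<alpha>)) * ennreal (dC j \<omega> powr (- 2 * \<alpha>))" for j \<omega>
  have [measurable]: "A u \<in> borel_measurable M" if "u \<in> {1..4}" for u
    unfolding A_def using that by measurable
  have [measurable]: "B j \<in> borel_measurable M" if "j \<in> {1..K}" for j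
    unfolding B_def using that by measurable
  have Y: "ennreal (?Y \<omega>) = 2 * (\<Sum>u=1..4. A u \<omega>) + ennreal g * (\<Sum>j=1..K. B j \<omega>)" for \<omega>
    using g by (simp add: A_def B_def ennreal_plus ennreal_mult sum_nonneg sum_distrib_left[symmetric] flip: sum_ennreal)
  have "(\<integral>\<^sup>+\<omega>. ennreal (?Y \<omega>) \<partial>M)
     = 2 * (\<Sum>u=1..4. \<integral>\<^sup>+\<omega>. A u \<omega> \<partial>M) + ennreal g * (\<Sum>j=1..K. \<integral>\<^sup>+\<omega>. B j \<omega> \<partial>M)"
    unfolding Y by (simp add: nn_integral_add nn_integral_cmult del: One_nat_def flip: nn_integral_sum)
  also have "\<dots> \<le> 2 * (\<Sum>u=1..4. ennreal (\<rho> u * (len * wid) / 2 * \<Omega>VN * \<Omega>CP)) + ennreal g * (\<Sum>j=1..K. ennreal (\<Omega>CN * \<Omega>CP))"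
    unfolding A_def B_def
    by (intro add_mono mult_left_mono sum_mono nn_integral_CUE_pair_le[OF k]
        order_eq_refl[OF nn_integral_V2V_interference[OF k]]) auto
  also have "(\<Sum>u=1..4. ennreal (\<rho> u * (len * wid) / 2 * \<Omega>VN * \<Omega>CP)) = ennreal (\<Sum>u=1..4. \<rho> u * (len * wid) / 2 * \<Omega>VN * \<Omega>CP)"
    using density_pos dims VN0 CP0 by (intro sum_ennreal) (auto simp: less_imp_le)
  also have "(\<Sum>j=1..K. ennreal (\<Omega>CN * \<Omega>CP)) = ennreal (real K * (\<Omega>CN * \<Omega>CP))"
    using CN0 CP0 by (simp add: ennreal_mult ennreal_of_nat_eq_real_of_nat)
  also have "2 * ennreal (\<Sum>u=1..4. \<rho> u * (len * wid) / 2 * \<Omega>VN * \<Omega>CP) + ennreal g * ennreal (real K * (\<Omega>CN * \<Omega>CP))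
    = ennreal (2 * (\<Sum>u=1..4. \<rho> u * (len * wid) / 2 * \<Omega>VN * \<Omega>CP) + g * (real K * (\<Omega>CN * \<Omega>CP)))"
  proof -
    have "0 \<le> (\<Sum>u=1..4. \<rho> u * (len * wid) / 2 * \<Omega>VN * \<Omega>CP)"
      using density_pos dims VN0 CP0 by (intro sum_nonneg) (auto simp: less_imp_le)
    then show ?thesis using g CN0 CP0 by (simp add: ennreal_plus ennreal_mult)
  qed
  also have "2 * (\<Sum>u=1..4. \<rho> u * (len * wid) / 2 * \<Omega>VN * \<Omega>CP) + g * (real K * (\<Omega>CN * \<Omega>CP))
    = (\<Sum>u=1..4. \<rho> u * (len * wid) * \<Omega>VN * \<Omega>CP) + real K * g * \<Omega>CN * \<Omega>CP"
    unfolding sum_distrib_left by (simp add: mult_ac)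
  finally show ?thesis .
qed

section \<open>The worst-case bound averaged over the deployment\<close>

lemma fading_squared:
  assumes "0 < d"
  shows "(fading \<theta> \<alpha> d)\<^sup>2 = \<theta>\<^sup>2 * d powr (- 2 * \<alpha>)"
  using assms by (simp add: fading_def power_mult_distrib power2_eq_square flip: powr_add)

text \<open>Pointwise the bound equals \<open>a / Y\<close> with constant \<open>a\<close>: \<theta>
  cancels and the powers survive only through their ratio \<psi>. Jensen's inequality puts the mean
  of \<open>Y\<close> below \<open>a\<close>, and replacing that mean by its upper estimate only
  lowers the quotient.\<close>

lemma mean_sinr_bound_le:
  assumes k: "k \<in> {1..K}" and "0 < \<theta>" and P: "0 < PV" "0 < PC"
  shows "mean_sinr_bound s \<tau>RP \<tau>SP K (PC / PV) \<rho> (len * wid) \<Omega>VN \<Omega>CN \<Omega>CP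
    \<le> (\<integral>\<^sup>+ \<omega>. sinr_bound s \<tau>RP \<tau>SP K (\<lambda>u. D u \<omega>)
            (\<lambda>u d. worst_power s PV) (\<lambda>u d. worst_power s PV)
            (\<lambda>j. worst_power s PC) (\<lambda>j. worst_power s PC)
            (\<lambda>u d. fading \<theta> \<alpha> (dV u d \<omega>)) (\<lambda>j. fading \<theta> \<alpha> (dC j \<omega>)) k \<partial>M)"
proof -
  define \<psi> where "\<psi> = PC / PV"
  define g where "g = (case s of RP \<Rightarrow> 0 | SP \<Rightarrow> \<psi>\<^sup>2)"
  define a where "a = (case s of RP \<Rightarrow> 2 * real \<tau>RP * \<psi>\<^sup>2 | SP \<Rightarrow> real \<tau>SP * \<psi>\<^sup>2)"
  define V where "V = (\<lambda>\<omega>. \<Sum>u=1..4. \<Sum>d=1..D u \<omega>. dV u d \<omega> powr (- 2 * \<alpha>))"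
  define C where "C = (\<lambda>\<omega>. \<Sum>j=1..K. dC j \<omega> powr (- 2 * \<alpha>))"
  define X where "X = (\<lambda>\<omega>. dC k \<omega> powr (2 * \<alpha>))"
  define Y where "Y = (\<lambda>\<omega>. 2 * (X \<omega> * V \<omega>) + g * (X \<omega> * C \<omega>))"
  have g: "0 \<le> g" by (simp add: g_def split: scheme.split)
  have [measurable]: "(\<lambda>\<omega>. \<Sum>d=1..D u \<omega>. dV u d \<omega> powr (- 2 * \<alpha>)) \<in> borel_measurable M"
    if u: "u \<in> {1..4}" for u
    by (intro borel_measurable_sum_random_length D_measurable[OF u] measurable_compose[OF dV_measurable[OF u]]) auto
  have [measurable]: "dC j \<in> borel_measurable M" if "j \<in> {1..K}" for j
    using that by (rule dC_measurable)
  note [measurable] = dC_measurable[OF k]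
  have [measurable]: "V \<in> borel_measurable M" "C \<in> borel_measurable M" "X \<in> borel_measurable M"
    unfolding V_def C_def X_def by measurable
  have [measurable]: "Y \<in> borel_measurable M" unfolding Y_def by measurable
  have "mean_sinr_bound s \<tau>RP \<tau>SP K \<psi> \<rho> (len * wid) \<Omega>VN \<Omega>CN \<Omega>CP
    = ennreal a / ennreal ((\<Sum>u=1..4. \<rho> u * (len * wid) * \<Omega>VN * \<Omega>CP) + real K * g * \<Omega>CN * \<Omega>CP)"
    by (simp add: mean_sinr_bound_def a_def g_def split: scheme.split)
  also have "\<dots> \<le> ennreal a / (\<integral>\<^sup>+\<omega>. ennreal (Y \<omega>) \<partial>M)"
    unfolding Y_def X_def V_def C_def
    unfolding divide_ennreal_def
    by (intro mult_left_mono inverse_antimono_ennreal nn_integral_interference_le k g) simp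
  also have "\<dots> \<le> (\<integral>\<^sup>+\<omega>. ennreal a / ennreal (Y \<omega>) \<partial>M)"
    by (intro divide_nn_integral_le) auto
  also have "\<dots> = (\<integral>\<^sup>+ \<omega>. sinr_bound s \<tau>RP \<tau>SP K (\<lambda>u. D u \<omega>)
            (\<lambda>u d. worst_power s PV) (\<lambda>u d. worst_power s PV)
            (\<lambda>j. worst_power s PC) (\<lambda>j. worst_power s PC)
            (\<lambda>u d. fading \<theta> \<alpha> (dV u d \<omega>)) (\<lambda>j. fading \<theta> \<alpha> (dC j \<omega>)) k \<partial>M)"
  proof (intro nn_integral_cong)
    fix \<omega> assume \<omega>: "\<omega> \<in> space M"
    have X: "0 < X \<omega>" "dC k \<omega> powr (- 2 * \<alpha>) = 1 / X \<omega>"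
      using CUE_distances_pos[OF k \<omega>] by (auto simp: X_def powr_minus field_simps)
    have V0: "0 \<le> V \<omega>" and C0: "0 \<le> C \<omega>"
      by (auto simp: V_def C_def intro!: sum_nonneg)
    have sumV: "(\<Sum>u=1..4. \<Sum>d=1..D u \<omega>. q * (fading \<theta> \<alpha> (dV u d \<omega>))\<^sup>2) = q * \<theta>\<^sup>2 * V \<omega>" for q
      unfolding V_def sum_distrib_left
      by (intro sum.cong refl) (simp add: fading_squared V2V_distances_pos \<omega>)
    have sumC: "(\<Sum>j=1..K. q * (fading \<theta> \<alpha> (dC j \<omega>))\<^sup>2) = q * \<theta>\<^sup>2 * C \<omega>" for q
      unfolding C_def sum_distrib_left
      by (intro sum.cong refl) (simp add: fading_squared CUE_distances_pos \<omega>)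
    have Ck: "(fading \<theta> \<alpha> (dC k \<omega>))\<^sup>2 = \<theta>\<^sup>2 * (1 / X \<omega>)"
      using fading_squared[OF CUE_distances_pos[OF k \<omega>]] X(2) by simp
    show "ennreal a / ennreal (Y \<omega>) = sinr_bound s \<tau>RP \<tau>SP K (\<lambda>u. D u \<omega>)
            (\<lambda>u d. worst_power s PV) (\<lambda>u d. worst_power s PV)
            (\<lambda>j. worst_power s PC) (\<lambda>j. worst_power s PC)
            (\<lambda>u d. fading \<theta> \<alpha> (dV u d \<omega>)) (\<lambda>j. fading \<theta> \<alpha> (dC j \<omega>)) k"
    proof (cases s)
      case RP
      \<comment> \<open>The common factor of numerator and denominator. Its 1/2 offsets the 2 that
        \<open>a\<close> and \<open>Y\<close> carry.\<close>
      define t where "t = PV\<^sup>2 * \<theta>\<^sup>2 / (2 * X \<omega>)"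
      have "sinr_bound s \<tau>RP \<tau>SP K (\<lambda>u. D u \<omega>)
            (\<lambda>u d. worst_power s PV) (\<lambda>u d. worst_power s PV)
            (\<lambda>j. worst_power s PC) (\<lambda>j. worst_power s PC)
            (\<lambda>u d. fading \<theta> \<alpha> (dV u d \<omega>)) (\<lambda>j. fading \<theta> \<alpha> (dC j \<omega>)) k
          = ennreal (real \<tau>RP * PC * PC * (\<theta>\<^sup>2 * (1 / X \<omega>))) / ennreal (PV * PV * \<theta>\<^sup>2 * V \<omega>)"
        unfolding RP sinr_bound_def worst_power_def scheme.case sumV Ck ..
      also have "real \<tau>RP * PC * PC * (\<theta>\<^sup>2 * (1 / X \<omega>)) = t * a"
        using P X by (simp add: t_def a_def RP \<psi>_def field_simps power2_eq_square)
      also have "PV * PV * \<theta>\<^sup>2 * V \<omega> = t * Y \<omega>"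
        using P X by (simp add: t_def Y_def g_def RP field_simps power2_eq_square)
      also have "ennreal (t * a) / ennreal (t * Y \<omega>) = ennreal a / ennreal (Y \<omega>)"
        using P X V0 \<open>0 < \<theta>\<close>
        by (intro ennreal_divide_cancel) (auto simp: t_def a_def Y_def g_def RP)
      finally show ?thesis ..
    next
      case SP
      \<comment> \<open>Here no 1/2 is required: with equal data and pilot powers the two V2V sums
        coincide and produce the 2 in \<open>Y\<close>.\<close>
      define t where "t = (PV / 2)\<^sup>2 * \<theta>\<^sup>2 / X \<omega>"
      have "sinr_bound s \<tau>RP \<tau>SP K (\<lambda>u. D u \<omega>)
            (\<lambda>u d. worst_power s PV) (\<lambda>u d. worst_power s PV)
            (\<lambda>j. worst_power s PC) (\<lambda>j. worst_power s PC)
            (\<lambda>u d. fading \<theta> \<alpha> (dV u d \<omega>)) (\<lambda>j. fading \<theta> \<alpha> (dC j \<omega>)) k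
          = ennreal (real \<tau>SP * (PC / 2) * (PC / 2) * (\<theta>\<^sup>2 * (1 / X \<omega>)))
            / ennreal ((PV / 2) * (PV / 2) * \<theta>\<^sup>2 * V \<omega> + (PC / 2)\<^sup>2 * \<theta>\<^sup>2 * C \<omega> + (PV / 2)\<^sup>2 * \<theta>\<^sup>2 * V \<omega>)"
        unfolding SP sinr_bound_def worst_power_def scheme.case sumV sumC Ck ..
      also have "real \<tau>SP * (PC / 2) * (PC / 2) * (\<theta>\<^sup>2 * (1 / X \<omega>)) = t * a"
        using P X by (simp add: t_def a_def SP \<psi>_def field_simps power2_eq_square)
      also have "(PV / 2) * (PV / 2) * \<theta>\<^sup>2 * V \<omega> + (PC / 2)\<^sup>2 * \<theta>\<^sup>2 * C \<omega> + (PV / 2)\<^sup>2 * \<theta>\<^sup>2 * V \<omega> = t * Y \<omega>"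
        using P X by (simp add: t_def Y_def g_def SP \<psi>_def field_simps power2_eq_square)
      also have "ennreal (t * a) / ennreal (t * Y \<omega>) = ennreal a / ennreal (Y \<omega>)"
        using P X V0 C0 g \<open>0 < \<theta>\<close>
        by (intro ennreal_divide_cancel) (auto simp: t_def a_def Y_def SP)
      finally show ?thesis ..
    qed
  qed
  finally show ?thesis by (simp add: \<psi>_def)
qed

end

theorem theorem2:
  fixes s :: scheme
    and \<tau>RP \<tau>SP K k :: nat
    and \<theta> \<alpha> :: real
  assumes "1 \<le> K" and "k \<in> {1..K}"
    and "K \<le> \<tau>RP" and "\<tau>RP < \<tau>SP"
    and "0 < \<theta>" and "0 < \<alpha>"
  shows
    "(\<forall>(c :: nat \<Rightarrow> nat) (D :: nat \<Rightarrow> nat)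
        (pV :: nat \<Rightarrow> nat \<Rightarrow> real) (qV :: nat \<Rightarrow> nat \<Rightarrow> real)
        (pC :: nat \<Rightarrow> real) (qC :: nat \<Rightarrow> real)
        (dV :: nat \<Rightarrow> nat \<Rightarrow> real) (dC :: nat \<Rightarrow> real).
        inj_on c {1..K} \<and> c ` {1..K} \<subseteq> {1..num_pilots s \<tau>RP \<tau>SP} \<and>
        (\<forall>u\<in>{1..4}. \<forall>d\<in>{1..D u}. 0 < pV u d \<and> 0 < qV u d \<and> 0 < dV u d) \<and>
        (\<forall>j\<in>{1..K}. 0 < pC j \<and> 0 < qC j \<and> 0 < dC j)
        \<longrightarrow>
        pilot_mean_sinr s \<tau>RP \<tau>SP K c D pV qV pC qC
            (\<lambda>u d. fading \<theta> \<alpha> (dV u d)) (\<lambda>j. fading \<theta> \<alpha> (dC j)) k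
          \<ge> sinr_bound s \<tau>RP \<tau>SP K D pV qV pC qC
            (\<lambda>u d. fading \<theta> \<alpha> (dV u d)) (\<lambda>j. fading \<theta> \<alpha> (dC j)) k)
     \<and>
     (\<forall>(M :: 'w measure) (len :: real) (wid :: real) (h :: real) (x0 :: real) (w :: real)
        (\<rho> :: nat \<Rightarrow> real) (D :: nat \<Rightarrow> 'w \<Rightarrow> nat)
        (posV :: nat \<Rightarrow> nat \<Rightarrow> 'w \<Rightarrow> real \<times> real) (posC :: nat \<Rightarrow> 'w \<Rightarrow> real \<times> real)
        (\<Omega>VN :: real) (\<Omega>CN :: real) (\<Omega>CP :: real) (PVmax :: real) (PCmax :: real).
        random_deployment M K \<alpha> len wid h x0 w \<rho> D posV posC \<Omega>VN \<Omega>CN \<Omega>CP \<and>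
        0 < PVmax \<and> 0 < PCmax
        \<longrightarrow>
        (\<integral>\<^sup>+ \<omega>. sinr_bound s \<tau>RP \<tau>SP K (\<lambda>u. D u \<omega>)
            (\<lambda>u d. worst_power s PVmax) (\<lambda>u d. worst_power s PVmax)
            (\<lambda>j. worst_power s PCmax) (\<lambda>j. worst_power s PCmax)
            (\<lambda>u d. fading \<theta> \<alpha> (bs_dist (posV u d \<omega>)))
            (\<lambda>j. fading \<theta> \<alpha> (bs_dist (posC j \<omega>))) k \<partial>M)
          \<ge> mean_sinr_bound s \<tau>RP \<tau>SP K (PCmax / PVmax) \<rho> (len * wid) \<Omega>VN \<Omega>CN \<Omega>CP)"
proof (intro conjI allI impI; elim conjE)
  fix c D :: "nat \<Rightarrow> nat" and pV qV dV :: "nat \<Rightarrow> nat \<Rightarrow> real" and pC qC dC :: "nat \<Rightarrow> real"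
  assume "c ` {1..K} \<subseteq> {1..num_pilots s \<tau>RP \<tau>SP}"
    and "\<forall>u\<in>{1..4}. \<forall>d\<in>{1..D u}. 0 < pV u d \<and> 0 < qV u d \<and> 0 < dV u d"
    and "\<forall>j\<in>{1..K}. 0 < pC j \<and> 0 < qC j \<and> 0 < dC j"
  then show "sinr_bound s \<tau>RP \<tau>SP K D pV qV pC qC
            (\<lambda>u d. fading \<theta> \<alpha> (dV u d)) (\<lambda>j. fading \<theta> \<alpha> (dC j)) k
      \<le> pilot_mean_sinr s \<tau>RP \<tau>SP K c D pV qV pC qC
            (\<lambda>u d. fading \<theta> \<alpha> (dV u d)) (\<lambda>j. fading \<theta> \<alpha> (dC j)) k"
    using \<open>k \<in> {1..K}\<close>
    by (intro sinr_bound_le_pilot_mean_sinr) (blast intro: less_imp_le)+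
qed (intro random_deployment.mean_sinr_bound_le assms)

end
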